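(* We have $$\sum_{i,j,k\geq 0} \frac{(-1)^iq^{i^2+2j^2+k^2+2ij+2ik+2jk+3i}}{(q^2;q^2)_i(q^2;q^2)_j(q^2;q^2)_k}=\frac{(q^6;q^4)_\infty}{(q;q^4)_\infty(q^7;q^4)_\infty}.$$
   Context: Here $q$ is a complex number with $0<|q|<1$. For $|p|<1$, $(a;p)_\infty=\prod_{n\ge 0}(1-ap^n)$, and $(a;p)_n=(a;p)_\infty/(ap^n;p)_\infty=\prod_{k=0}^{n-1}(1-ap^k)$ for integers $n\ge 0$. The sum runs over all triples of nonnegative integers $(i,j,k)$. *)

theory Defs
  imports "HOL-Analysis.Analysis"
begin

definition qpoch :: "complex \<Rightarrow> complex \<Rightarrow> nat \<Rightarrow> complex" where
  "qpoch a p n = (\<Prod>k<n. 1 - a * p ^ k)"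

(* Only meaningful for norm p < 1, where the product converges; see qpoch_inf_has_prod. *)
definition qpoch_inf :: "complex \<Rightarrow> complex \<Rightarrow> complex" where
  "qpoch_inf a p = (\<Prod>n. 1 - a * p ^ n)"

lemma qpoch_inf_has_prod:
  assumes "norm p < 1"
  shows "(\<lambda>n. 1 - a * p ^ n) has_prod qpoch_inf a p"
proof -
  have "summable (\<lambda>n. norm a * norm p ^ n)"
    using assms by (intro summable_mult summable_geometric) simp
  then have "summable (\<lambda>n. norm ((1 - a * p ^ n) - 1))"
    by (simp add: norm_mult norm_power)
  then have "abs_convergent_prod (\<lambda>n. 1 - a * p ^ n)"
    by (rule summable_imp_abs_convergent_prod)
  then have "convergent_prod (\<lambda>n. 1 - a * p ^ n)"
    by (rule abs_convergent_prod_imp_convergent_prod)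
  then show ?thesis
    unfolding qpoch_inf_def by (rule convergent_prod_has_prod)
qed

end

theory Submission
  imports Defs
begin

text \<open>
  Write \<open>p = q\<^sup>2\<close> and \<open>N = i + j + k\<close>. The quadratic form is \<open>N\<^sup>2 + j\<^sup>2\<close>, so by Euler's two
  identities the terms with fixed \<open>N\<close> sum to \<open>q ^ N\<^sup>2\<close> times the coefficient of \<open>z ^ N\<close> in
  \<open>(-qz; p)\<^sub>\<infinity> / ((-q\<^sup>3z; p)\<^sub>\<infinity> (z; p)\<^sub>\<infinity>) = (1 + qz) / (z; p)\<^sub>\<infinity>\<close>. Hence the triple sum equals
  \<open>G 1 + q\<^sup>2 G p\<close> with \<open>G z = (\<Sum>n. q ^ n\<^sup>2 z ^ n / (p; p)\<^sub>n) = (-qz; p)\<^sub>\<infinity>\<close>,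
  that is \<open>(1 + q + q\<^sup>2) (-q\<^sup>3; q\<^sup>2)\<^sub>\<infinity>\<close>.
\<close>

section \<open>Finite and infinite q-Pochhammer products, and the product side\<close>

lemma qpoch_0 [simp]: "qpoch a p 0 = 1"
  by (simp add: qpoch_def)

lemma qpoch_Suc: "qpoch a p (Suc n) = qpoch a p n * (1 - a * p ^ n)"
  by (simp add: qpoch_def)

lemma qpoch_Suc_shift: "qpoch a p (Suc n) = (1 - a) * qpoch (a * p) p n"
  by (simp add: qpoch_def prod.lessThan_Suc_shift mult.assoc del: prod.lessThan_Suc)

lemma qpoch_double: "qpoch a p (2 * n) = qpoch a (p\<^sup>2) n * qpoch (a * p) (p\<^sup>2) n"
  by (induction n) (simp_all add: qpoch_Suc power_mult[symmetric] mult_ac)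

lemma qpoch_mult_minus: "qpoch a p n * qpoch (- a) p n = qpoch (a\<^sup>2) (p\<^sup>2) n"
  unfolding qpoch_def prod.distrib[symmetric]
  by (intro prod.cong) (simp_all add: algebra_simps power2_eq_square power_mult_distrib)

lemma one_minus_power_nonzero:
  fixes p :: complex
  assumes "norm p < 1" "n > 0"
  shows "1 - p ^ n \<noteq> 0"
proof
  assume "1 - p ^ n = 0"
  then have "norm p ^ n = 1" by (simp flip: norm_power)
  moreover have "norm p ^ n < 1"
    using assms power_less_one_iff[of "norm p" n] by simp
  ultimately show False by simp
qed

lemma qpoch_LIMSEQ:
  assumes "norm p < 1"
  shows "qpoch a p \<longlonglongrightarrow> qpoch_inf a p"
proof -
  have "(\<lambda>n. \<Prod>k\<le>n. 1 - a * p ^ k) \<longlonglongrightarrow> qpoch_inf a p"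
    using qpoch_inf_has_prod[OF assms]
    by (metis convergent_prod_LIMSEQ has_prod_iff)
  then have "(\<lambda>n. qpoch a p (Suc n)) \<longlonglongrightarrow> qpoch_inf a p"
    by (simp add: qpoch_def lessThan_Suc_atMost)
  then show ?thesis by (rule LIMSEQ_imp_Suc)
qed

text \<open>Since \<open>norm (a * p ^ n) <= norm a < 1\<close>, no factor vanishes, and a
  convergent product is zero only if one of its factors is.\<close>

lemma qpoch_inf_nonzero:
  assumes "norm p < 1" "norm a < 1"
  shows "qpoch_inf a p \<noteq> 0"
proof -
  have "1 - a * p ^ n \<noteq> 0" for n
  proof
    assume "1 - a * p ^ n = 0"
    then have "norm (a * p ^ n) = 1" by (metis eq_iff_diff_eq_0 norm_one)
    moreover have "norm (a * p ^ n) \<le> norm a"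
      using assms by (simp add: norm_mult norm_power mult_left_le power_le_one)
    ultimately show False using assms by simp
  qed
  then show ?thesis
    using has_prod_eq_0_iff[OF qpoch_inf_has_prod[OF assms(1), of a]]
    by (metis (no_types, lifting) rangeE)
qed

lemma qpoch_inf_shift:
  assumes "norm p < 1"
  shows "qpoch_inf a p = (1 - a) * qpoch_inf (a * p) p"
proof (rule LIMSEQ_unique)
  show "(\<lambda>n. qpoch a p (Suc n)) \<longlonglongrightarrow> qpoch_inf a p"
    using qpoch_LIMSEQ[OF assms] by (rule LIMSEQ_Suc)
  show "(\<lambda>n. qpoch a p (Suc n)) \<longlonglongrightarrow> (1 - a) * qpoch_inf (a * p) p"
    unfolding qpoch_Suc_shift by (intro tendsto_intros qpoch_LIMSEQ assms)
qed

lemma norm_power2_less_one: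
  fixes p :: complex
  assumes "norm p < 1"
  shows "norm (p\<^sup>2) < 1"
  using assms by (simp add: norm_power power_less_one_iff)

text \<open>The first \<open>2 * n\<close> factors separate into those of even and those of odd
  index; the even-length partial products form a subsequence with the same limit.\<close>

lemma qpoch_inf_split:
  assumes "norm p < 1"
  shows "qpoch_inf a p = qpoch_inf a (p\<^sup>2) * qpoch_inf (a * p) (p\<^sup>2)"
proof (rule LIMSEQ_unique)
  show "(\<lambda>n. qpoch a p (2 * n)) \<longlonglongrightarrow> qpoch_inf a p"
    using LIMSEQ_subseq_LIMSEQ[OF qpoch_LIMSEQ[OF assms], of "\<lambda>n. 2 * n"]
    by (simp add: strict_mono_def o_def)
  show "(\<lambda>n. qpoch a p (2 * n)) \<longlonglongrightarrow> qpoch_inf a (p\<^sup>2) * qpoch_inf (a * p) (p\<^sup>2)"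
    unfolding qpoch_double by (intro tendsto_intros qpoch_LIMSEQ norm_power2_less_one assms)
qed

lemma qpoch_inf_mult_minus:
  assumes "norm p < 1"
  shows "qpoch_inf a p * qpoch_inf (- a) p = qpoch_inf (a\<^sup>2) (p\<^sup>2)"
proof (rule LIMSEQ_unique)
  show "(\<lambda>n. qpoch a p n * qpoch (- a) p n) \<longlonglongrightarrow> qpoch_inf a p * qpoch_inf (- a) p"
    by (intro tendsto_intros qpoch_LIMSEQ assms)
  show "(\<lambda>n. qpoch a p n * qpoch (- a) p n) \<longlonglongrightarrow> qpoch_inf (a\<^sup>2) (p\<^sup>2)"
    unfolding qpoch_mult_minus by (intro qpoch_LIMSEQ norm_power2_less_one assms)
qed

text \<open>Multiplying \<open>qpoch_inf (- (q ^ 3)) (q^2)\<close> by its companion at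
  \<open>q ^ 3\<close> gives the numerator. The companion splits into products in base
  \<open>q ^ 4\<close> starting at \<open>q ^ 3\<close> and \<open>q ^ 5\<close>; shifting the first
  up to \<open>q ^ 7\<close> and the second down to \<open>q\<close> costs the quotient
  \<open>(1 - q ^ 3) / (1 - q) = 1 + q + q^2\<close>.\<close>

lemma product_side:
  assumes "norm q < 1"
  shows "(1 + q + q\<^sup>2) * qpoch_inf (- (q ^ 3)) (q\<^sup>2) =
    qpoch_inf (q ^ 6) (q ^ 4) / (qpoch_inf q (q ^ 4) * qpoch_inf (q ^ 7) (q ^ 4))"
proof -
  have n2: "norm (q\<^sup>2) < 1" and n4: "norm (q ^ 4) < 1"
    using norm_power2_less_one[OF assms] norm_power2_less_one[of "q\<^sup>2"] by simp_all
  have small: "norm (q ^ n) < 1" if "n > 0" for n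
    using assms that by (simp add: norm_power power_less_one_iff)
  have "qpoch_inf (q ^ 3) (q\<^sup>2) = qpoch_inf (q ^ 3) (q ^ 4) * qpoch_inf (q ^ 5) (q ^ 4)"
    using qpoch_inf_split[OF n2, of "q ^ 3"] by (simp add: power_mult[symmetric] power_add[symmetric])
  moreover have "qpoch_inf (q ^ 3) (q ^ 4) = (1 - q ^ 3) * qpoch_inf (q ^ 7) (q ^ 4)"
    using qpoch_inf_shift[OF n4, of "q ^ 3"] by (simp add: power_add[symmetric])
  moreover have q1: "qpoch_inf q (q ^ 4) = (1 - q) * qpoch_inf (q ^ 5) (q ^ 4)"
    using qpoch_inf_shift[OF n4, of q] by (simp add: power_Suc[symmetric] del: power_Suc)
  moreover have "qpoch_inf (q ^ 3) (q\<^sup>2) * qpoch_inf (- (q ^ 3)) (q\<^sup>2) = qpoch_inf (q ^ 6) (q ^ 4)"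
    using qpoch_inf_mult_minus[OF n2, of "q ^ 3"] by (simp add: power_mult[symmetric])
  moreover have "1 - q ^ 3 = (1 - q) * (1 + q + q\<^sup>2)"
    by (simp add: algebra_simps eval_nat_numeral)
  ultimately have "qpoch_inf (q ^ 6) (q ^ 4) = (1 + q + q\<^sup>2) * qpoch_inf (- (q ^ 3)) (q\<^sup>2) *
      (qpoch_inf q (q ^ 4) * qpoch_inf (q ^ 7) (q ^ 4))"
    by algebra
  moreover have "qpoch_inf q (q ^ 4) \<noteq> 0" "qpoch_inf (q ^ 7) (q ^ 4) \<noteq> 0"
    using qpoch_inf_nonzero[OF n4] assms small by simp_all
  ultimately show ?thesis by simp
qed

section \<open>Reciprocal bounds, coefficient convolution and product summability\<close>

lemma qpoch_self_nonzero:
  assumes "norm p < 1"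
  shows "qpoch p p n \<noteq> 0"
  using one_minus_power_nonzero[OF assms, of "Suc _"] by (simp add: qpoch_def)

text \<open>The reciprocals converge because the limit \<open>qpoch_inf p p\<close> is nonzero. The
  constant \<open>C\<close> removes the denominators in the comparison tests for both the single and
  the triple series.\<close>

lemma inverse_qpoch_bounded:
  assumes "norm p < 1"
  obtains C where "C > 0" "\<And>n. norm (1 / qpoch p p n) \<le> C"
proof -
  have "(\<lambda>n. 1 / qpoch p p n) \<longlonglongrightarrow> 1 / qpoch_inf p p"
    by (intro tendsto_intros qpoch_LIMSEQ qpoch_inf_nonzero assms)
  then have "Bseq (\<lambda>n. 1 / qpoch p p n)"
    by (intro convergent_imp_Bseq convergentI)
  then show ?thesis using that by (auto simp: Bseq_def)
qed

text \<open>\<open>f\<close> and \<open>g\<close> are the coefficients of \<open>1 / (az; p)\<^sub>\<infinity>\<close> and \<open>(-bz; p)\<^sub>\<infinity>\<close>. The recurrence comes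
  from the splitting \<open>1 - p ^ n = (1 - p ^ i) + p ^ i (1 - p ^ (n - i))\<close>.\<close>

lemma convolution_recurrence:
  fixes f g :: "nat \<Rightarrow> complex"
  assumes f: "\<And>i. f (Suc i) * (1 - p ^ Suc i) = a * f i"
    and g: "\<And>j. g (Suc j) * (1 - p ^ Suc j) = b * p ^ j * g j"
  shows "(1 - p ^ Suc m) * (\<Sum>i\<le>Suc m. f i * g (Suc m - i)) =
    (a + b * p ^ m) * (\<Sum>i\<le>m. f i * g (m - i))"
proof -
  have "(1 - p ^ Suc m) * (\<Sum>i\<le>Suc m. f i * g (Suc m - i)) =
    (\<Sum>i\<le>Suc m. f i * (1 - p ^ i) * g (Suc m - i)) +
    (\<Sum>i\<le>Suc m. p ^ i * f i * (g (Suc m - i) * (1 - p ^ (Suc m - i))))"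
    unfolding sum_distrib_left sum.distrib[symmetric]
  proof (rule sum.cong)
    fix i assume "i \<in> {..Suc m}"
    then have "p ^ Suc m = p ^ i * p ^ (Suc m - i)" by (simp flip: power_add)
    then show "(1 - p ^ Suc m) * (f i * g (Suc m - i)) = f i * (1 - p ^ i) * g (Suc m - i) +
        p ^ i * f i * (g (Suc m - i) * (1 - p ^ (Suc m - i)))"
      by (simp add: algebra_simps del: power_Suc)
  qed simp
  \<comment> \<open>Here the term \<open>i = 0\<close> vanishes because
    \<open>1 - p ^ 0 = 0\<close>; in the second sum the term \<open>i = Suc m\<close> vanishes for
    the same reason. What remains is indexed by \<open>i <= m\<close> in both cases.\<close>
  also have "(\<Sum>i\<le>Suc m. f i * (1 - p ^ i) * g (Suc m - i)) = a * (\<Sum>i\<le>m. f i * g (m - i))"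
    by (simp add: sum.atMost_Suc_shift f sum_distrib_left mult.assoc[of a] del: sum.atMost_Suc power_Suc)
  also have "(\<Sum>i\<le>Suc m. p ^ i * f i * (g (Suc m - i) * (1 - p ^ (Suc m - i)))) =
      (\<Sum>i\<le>m. p ^ i * f i * (b * p ^ (m - i) * g (m - i)))"
    by (simp add: Suc_diff_le g del: power_Suc)
  also have "\<dots> = b * p ^ m * (\<Sum>i\<le>m. f i * g (m - i))"
    unfolding sum_distrib_left
  proof (rule sum.cong)
    fix i assume "i \<in> {..m}"
    then have "p ^ m = p ^ i * p ^ (m - i)" by (simp flip: power_add)
    then show "p ^ i * f i * (b * p ^ (m - i) * g (m - i)) = b * p ^ m * (f i * g (m - i))"
      by simp
  qed simp
  finally show ?thesis by (simp only: distrib_right)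
qed

text \<open>Nonnegativity reduces summability over pairs to that of the iterated sums. Two
  applications yield a geometric majorant over triples.\<close>

lemma summable_on_times_nonneg:
  fixes f :: "'a \<Rightarrow> real" and g :: "'b \<Rightarrow> real"
  assumes f: "f summable_on UNIV" "\<And>x. f x \<ge> 0" and g: "g summable_on UNIV" "\<And>y. g y \<ge> 0"
  shows "(\<lambda>(x, y). f x * g y) summable_on UNIV"
proof -
  have "(\<lambda>(x, y). f x * g y) summable_on UNIV \<times> UNIV"
  proof (rule summable_on_SigmaI)
    show "((\<lambda>y. case (x, y) of (x, y) \<Rightarrow> f x * g y) has_sum f x * infsum g UNIV) UNIV" for x
      using has_sum_cmult_right[OF has_sum_infsum[OF g(1)], of "f x"] by simp
    show "(\<lambda>x. f x * infsum g UNIV) summable_on UNIV"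
      by (rule summable_on_cmult_left[OF f(1)])
  qed (use f g in simp)
  then show ?thesis by simp
qed

context
  fixes q :: complex
  assumes q: "norm q < 1"
begin

abbreviation (input) D :: "nat \<Rightarrow> complex" where
  "D \<equiv> qpoch (q\<^sup>2) (q\<^sup>2)"

lemma D_nonzero: "D n \<noteq> 0"
  by (rule qpoch_self_nonzero[OF norm_power2_less_one[OF q]])

lemma D_Suc: "D (Suc n) = D n * (1 - (q\<^sup>2) ^ Suc n)"
  by (simp add: qpoch_Suc)

lemma D_factor_nonzero: "1 - (q\<^sup>2) ^ Suc n \<noteq> 0"
  by (rule one_minus_power_nonzero[OF norm_power2_less_one[OF q]]) simp

text \<open>With \<open>a = - (q ^ 3)\<close>, \<open>b = q\<close> and base \<open>q^2\<close>, the
  recurrence carries the factor \<open>- (q ^ 3) + q ^ (2 * m + 1)\<close>. It vanishes at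
  \<open>m = 1\<close>, which kills the coefficient of index 2 and hence all later ones.\<close>

lemma convolution_eval:
  "(\<Sum>i\<le>n. (- (q ^ 3)) ^ i / D i * (q ^ (n - i)\<^sup>2 / D (n - i))) =
    (if n = 0 then 1 else if n = 1 then q else 0)"
proof -
  define f where "f i = (- (q ^ 3)) ^ i / D i" for i
  define g where "g j = q ^ j\<^sup>2 / D j" for j
  define c where "c n = (\<Sum>i\<le>n. f i * g (n - i))" for n
  have f: "f (Suc i) * (1 - (q\<^sup>2) ^ Suc i) = - (q ^ 3) * f i" for i
    using D_nonzero[of i] D_factor_nonzero[of i]
    by (simp add: f_def D_Suc del: power_Suc) simp
  have g: "g (Suc j) * (1 - (q\<^sup>2) ^ Suc j) = q * (q\<^sup>2) ^ j * g j" for j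
  proof -
    have "(Suc j)\<^sup>2 = Suc (2 * j + j\<^sup>2)" by (simp add: power2_eq_square)
    then have "q ^ (Suc j)\<^sup>2 = q * (q\<^sup>2) ^ j * q ^ j\<^sup>2"
      by (simp add: power_add power_mult)
    then show ?thesis
      using D_nonzero[of j] D_factor_nonzero[of j]
      by (simp add: g_def D_Suc del: power_Suc)
  qed
  have rec: "(1 - (q\<^sup>2) ^ Suc m) * c (Suc m) = (- (q ^ 3) + q * (q\<^sup>2) ^ m) * c m" for m
    unfolding c_def by (rule convolution_recurrence[OF f g])
  have c0: "c 0 = 1" by (simp add: c_def f_def g_def)
  have "(1 - q\<^sup>2) * c 1 = (1 - q\<^sup>2) * q"
    using rec[of 0] c0 by (simp add: algebra_simps eval_nat_numeral)
  then have c1: "c 1 = q" using D_factor_nonzero[of 0] by simp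
  have c2: "c (Suc (Suc m)) = 0" for m
  proof (induction m)
    case 0
    have "- (q ^ 3) + q * (q\<^sup>2) ^ 1 = 0" by (simp add: eval_nat_numeral)
    then show ?case using rec[of 1] D_factor_nonzero[of 1] by simp
  next
    case (Suc m)
    then show ?case using rec[of "Suc (Suc m)"] D_factor_nonzero[of "Suc (Suc m)"]
      by (simp del: power_Suc)
  qed
  have "c n = (if n = 0 then 1 else if n = 1 then q else 0)"
    proof (cases "n < 2")
    case True
    then show ?thesis using c0 c1 by (auto simp: less_2_cases_iff)
  next
    case False
    then show ?thesis using c2[of "n - 2"] by (simp add: numeral_2_eq_2 Suc_diff_Suc)
  qed
  then show ?thesis by (simp add: c_def f_def g_def)
qed


section \<open>The single series \<open>G\<close> and its infinite product\<close>

lemma norm_power_square_le: "norm (q ^ n\<^sup>2) \<le> norm q ^ n"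
  using q by (simp add: norm_power power_decreasing power2_nat_le_imp_le)

definition G :: "complex \<Rightarrow> complex" where
  "G z = (\<Sum>n. q ^ n\<^sup>2 / D n * z ^ n)"

text \<open>The decay comes from \<open>q ^ n^2\<close> alone, so the closed unit disc is covered
  and \<open>G 1\<close> is available.\<close>

lemma G_summable:
  assumes "norm z \<le> 1"
  shows "summable (\<lambda>n. q ^ n\<^sup>2 / D n * z ^ n)"
proof -
  obtain C where C: "C > 0" "\<And>n. norm (1 / D n) \<le> C"
    using inverse_qpoch_bounded[OF norm_power2_less_one[OF q]] by blast
  show ?thesis
  proof (rule summable_comparison_test)
    show "summable (\<lambda>n. C * norm q ^ n)"
      using q by (intro summable_mult summable_geometric) simp
    have "norm (q ^ n\<^sup>2 / D n * z ^ n) \<le> C * norm q ^ n" for n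
    proof -
      have "norm (q ^ n\<^sup>2 / D n * z ^ n) = norm (1 / D n) * norm (q ^ n\<^sup>2) * norm (z ^ n)"
        by (simp add: norm_mult norm_divide)
      also have "\<dots> \<le> C * norm q ^ n * 1"
        using C assms norm_power_square_le[of n]
        by (intro mult_mono) (simp_all add: norm_power power_le_one less_imp_le)
      finally show ?thesis by simp
    qed
    then show "\<exists>N. \<forall>n\<ge>N. norm (q ^ n\<^sup>2 / D n * z ^ n) \<le> C * norm q ^ n" by blast
  qed
qed

lemma G_0: "G 0 = 1"
  using powser_zero[of "\<lambda>n. q ^ n\<^sup>2 / D n"] by (simp add: G_def)

lemma isCont_G_0: "isCont G 0"
  unfolding G_def using G_summable[of 1]
  by (intro isCont_powser[where K = 1]) auto

text \<open>In \<open>G z - G (z * q^2)\<close> each coefficient gains the factor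
  \<open>1 - (q^2) ^ n\<close>, which cancels the last factor of \<open>D n\<close> and leaves
  \<open>q * z\<close> times the previous term of \<open>G (z * q^2)\<close>.\<close>

lemma G_shift:
  assumes "norm z \<le> 1"
  shows "G z = (1 + q * z) * G (z * q\<^sup>2)"
proof -
  let ?a = "\<lambda>n. q ^ n\<^sup>2 / D n"
  have "norm (z * q\<^sup>2) \<le> 1"
    using assms norm_power2_less_one[OF q] by (simp add: norm_mult mult_le_one)
  note sums = summable_sums[OF G_summable[OF this], folded G_def]
    summable_sums[OF G_summable[OF assms], folded G_def]
  have step: "?a (Suc n) * z ^ Suc n - ?a (Suc n) * (z * q\<^sup>2) ^ Suc n =
      q * z * (?a n * (z * q\<^sup>2) ^ n)" for n
  proof -
    have "(Suc n)\<^sup>2 = Suc (2 * n + n\<^sup>2)" by (simp add: power2_eq_square)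
    then have "q ^ (Suc n)\<^sup>2 = q * (q\<^sup>2) ^ n * q ^ n\<^sup>2"
      by (simp add: power_add power_mult)
    then have "?a (Suc n) * (1 - (q\<^sup>2) ^ Suc n) = q * (q\<^sup>2) ^ n * ?a n"
      using D_nonzero[of n] D_factor_nonzero[of n] by (simp add: D_Suc del: power_Suc)
    then have "?a (Suc n) * (1 - (q\<^sup>2) ^ Suc n) * z ^ Suc n = q * (q\<^sup>2) ^ n * ?a n * z ^ Suc n"
      by simp
    then show ?thesis
      unfolding power_mult_distrib by (simp only: power_Suc[of z] right_diff_distrib left_diff_distrib mult_1_left mult_ac)
  qed
  have "(\<lambda>n. ?a (Suc n) * z ^ Suc n - ?a (Suc n) * (z * q\<^sup>2) ^ Suc n) sums
      (q * z * G (z * q\<^sup>2))"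
    unfolding step by (intro sums_mult sums)
  \<comment> \<open>The index may start at 0 because the two constant terms cancel.\<close>
  then have "(\<lambda>n. ?a n * z ^ n - ?a n * (z * q\<^sup>2) ^ n) sums (q * z * G (z * q\<^sup>2))"
    by (subst (asm) sums_Suc_iff) simp
  then have "G z - G (z * q\<^sup>2) = q * z * G (z * q\<^sup>2)"
    using sums_diff[OF sums(2,1)] sums_unique2 by blast
  then show ?thesis by (simp add: algebra_simps)
qed

text \<open>Iterating \<open>G_shift\<close> peels off \<open>n\<close> factors and moves the
  argument to \<open>z * (q^2) ^ n\<close>, which tends to 0; continuity of \<open>G\<close> at 0
  and \<open>G 0 = 1\<close> finish the limit.\<close>

lemma G_eq_qpoch_inf:
  assumes "norm z \<le> 1"
  shows "G z = qpoch_inf (- (q * z)) (q\<^sup>2)"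
proof -
  have le: "norm (z * (q\<^sup>2) ^ n) \<le> 1" for n
    using assms q by (simp add: norm_mult norm_power power_le_one mult_le_one)
  have "G z = qpoch (- (q * z)) (q\<^sup>2) n * G (z * (q\<^sup>2) ^ n)" for n
  proof (induction n)
    case (Suc n)
    then show ?case using G_shift[OF le[of n]] by (simp add: qpoch_Suc mult_ac)
  qed simp
  then have "(\<lambda>n. qpoch (- (q * z)) (q\<^sup>2) n * G (z * (q\<^sup>2) ^ n)) \<longlonglongrightarrow> G z"
    by simp
  moreover have "(\<lambda>n. qpoch (- (q * z)) (q\<^sup>2) n * G (z * (q\<^sup>2) ^ n)) \<longlonglongrightarrow>
      qpoch_inf (- (q * z)) (q\<^sup>2) * G (z * 0)"
    using isCont_G_0 norm_power2_less_one[OF q]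
    by (intro tendsto_mult qpoch_LIMSEQ isCont_tendsto_compose[of _ G] tendsto_const
        LIMSEQ_power_zero) simp_all
  ultimately show ?thesis using LIMSEQ_unique G_0 by fastforce
qed

section \<open>The triple sum, grouped by \<open>i + j + k\<close>\<close>

definition triple_term :: "nat \<times> nat \<times> nat \<Rightarrow> complex" where
  "triple_term = (\<lambda>(i, j, k). (-1) ^ i * q ^ (i\<^sup>2 + 2*j\<^sup>2 + k\<^sup>2 + 2*i*j + 2*i*k + 2*j*k + 3*i)
    / (D i * D j * D k))"

text \<open>Separates the variables: once the total is fixed, only one-index factors remain, with
  the sign and the linear exponent \<open>3 * i\<close> merged into a power of
  \<open>- (q ^ 3)\<close>.\<close>

lemma triple_term_eq:
  "triple_term (i, j, k) =
    q ^ (i + j + k)\<^sup>2 * ((- (q ^ 3)) ^ i / D i * (q ^ j\<^sup>2 / D j) / D k)"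
proof -
  have "i\<^sup>2 + 2*j\<^sup>2 + k\<^sup>2 + 2*i*j + 2*i*k + 2*j*k + 3*i = (i + j + k)\<^sup>2 + j\<^sup>2 + 3 * i"
    by (simp add: power2_eq_square algebra_simps)
  moreover have "(- (q ^ 3)) ^ i = (-1) ^ i * q ^ (3 * i)"
    by (metis power_minus power_mult)
  ultimately show ?thesis
    by (simp only: triple_term_def prod.case) (simp add: power_add)
qed

text \<open>The exponent is at least \<open>i + j + k\<close>, so a product of three geometric
  series times \<open>C ^ 3\<close> dominates.\<close>

lemma triple_term_summable: "triple_term summable_on UNIV"
proof -
  obtain C where C: "C > 0" "\<And>n. norm (1 / D n) \<le> C"
    using inverse_qpoch_bounded[OF norm_power2_less_one[OF q]] by blast
  let ?r = "\<lambda>n. norm q ^ n"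
  have r: "?r summable_on UNIV"
    using q by (intro norm_summable_imp_summable_on) (simp add: summable_geometric)
  have "(\<lambda>(i, j, k). ?r i * (?r j * ?r k)) summable_on UNIV"
    using summable_on_times_nonneg[OF r _ summable_on_times_nonneg[OF r _ r]]
    by (auto simp: case_prod_unfold)
  then have *: "(\<lambda>x. C ^ 3 * (case x of (i, j, k) \<Rightarrow> ?r i * (?r j * ?r k))) summable_on UNIV"
    by (intro summable_on_cmult_right) simp
  have "norm (triple_term x) \<le> C ^ 3 * (case x of (i, j, k) \<Rightarrow> ?r i * (?r j * ?r k))" for x
  proof (cases x)
    case (fields i j k)
    have "norm (triple_term (i, j, k)) = norm q ^ ((i + j + k)\<^sup>2 + j\<^sup>2 + 3 * i) *
        (norm (1 / D i) * norm (1 / D j) * norm (1 / D k))"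
      by (simp add: triple_term_eq norm_mult norm_divide norm_power power_add power_mult)
    also have "\<dots> \<le> norm q ^ (i + j + k) * (C * C * C)"
    proof (intro mult_mono C power_decreasing)
      show "i + j + k \<le> (i + j + k)\<^sup>2 + j\<^sup>2 + 3 * i"
        by (simp add: power2_eq_square trans_le_add1)
    qed (use q C in simp_all)
    finally show ?thesis by (simp add: fields power_add eval_nat_numeral mult_ac)
  qed
  then have "(\<lambda>x. norm (triple_term x)) summable_on UNIV"
    by (intro Infinite_Sum.abs_summable_on_comparison_test'[OF *])
  then show ?thesis by (rule abs_summable_summable)
qed

text \<open>Summing first over \<open>i + j = m\<close> produces \<open>convolution_eval\<close>, so
  only \<open>m = 0\<close> and \<open>m = 1\<close> survive, that is \<open>k = N\<close> and
  \<open>k = N - 1\<close>.\<close>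

lemma sum_triple_term:
  "(\<Sum>(i, j, k) | i + j + k = N. triple_term (i, j, k)) =
    q ^ N\<^sup>2 / D N + (if N = 0 then 0 else q ^ N\<^sup>2 * q / D (N - 1))"
proof -
  let ?u = "\<lambda>i j. (- (q ^ 3)) ^ i / D i * (q ^ j\<^sup>2 / D j)"
  have "(\<Sum>(i, j, k) | i + j + k = N. triple_term (i, j, k)) =
    (\<Sum>(m, i) \<in> Sigma {..N} (\<lambda>m. {..m}). q ^ N\<^sup>2 * (?u i (m - i) / D (N - m)))"
    by (rule sum.reindex_bij_witness[of _ "\<lambda>(m, i). (i, m - i, N - m)" "\<lambda>(i, j, k). (i + j, i)"])
      (auto simp: triple_term_eq)
  also have "\<dots> = (\<Sum>m\<le>N. \<Sum>i\<le>m. q ^ N\<^sup>2 * (?u i (m - i) / D (N - m)))"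
    by (simp add: sum.Sigma)
  also have "\<dots> = q ^ N\<^sup>2 * (\<Sum>m\<le>N. (\<Sum>i\<le>m. ?u i (m - i)) / D (N - m))"
    by (simp only: sum_distrib_left sum_divide_distrib)
  \<comment> \<open>The index \<open>m = 1\<close> lies in the range only when \<open>N > 0\<close>,
    whence the case distinction on \<open>N\<close> in the result.\<close>
  also have "(\<Sum>m\<le>N. (\<Sum>i\<le>m. ?u i (m - i)) / D (N - m)) =
      (\<Sum>m\<le>N. (if m = 0 then 1 / D N else 0) + (if m = 1 then q / D (N - 1) else 0))"
    unfolding convolution_eval by (intro sum.cong) auto
  also have "\<dots> = 1 / D N + (if N = 0 then 0 else q / D (N - 1))"
    unfolding sum.distrib by (simp add: sum.delta)
  finally show ?thesis by (simp add: algebra_simps)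
qed

text \<open>Tagging each triple with its total turns the index set into a disjoint union of the
  finite fibres \<open>T N\<close>; unconditional summability permits summing fibre by
  fibre.\<close>

lemma triple_term_has_sum:
  "(triple_term has_sum ((1 + q + q\<^sup>2) * qpoch_inf (- (q ^ 3)) (q\<^sup>2))) UNIV"
proof -
  define T :: "nat \<Rightarrow> (nat \<times> nat \<times> nat) set" where "T N = {(i, j, k). i + j + k = N}" for N
  define s where "s N = q ^ N\<^sup>2 / D N + (if N = 0 then 0 else q ^ N\<^sup>2 * q / D (N - 1))" for N
  obtain S where S: "(triple_term has_sum S) UNIV"
    using triple_term_summable by (auto simp: summable_on_def)
  have "bij_betw snd (Sigma UNIV T) UNIV"
    by (rule bij_betw_byWitness[of _ "\<lambda>(i, j, k). (i + j + k, i, j, k)"]) (auto simp: T_def)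
  then have S': "((\<lambda>x. triple_term (snd x)) has_sum S) (Sigma UNIV T)"
    using S has_sum_reindex_bij_betw by blast
  have "((\<lambda>y. triple_term (snd (N, y))) has_sum s N) (T N)" for N
  proof (rule has_sum_finiteI)
    have "T N \<subseteq> {..N} \<times> {..N} \<times> {..N}" by (auto simp: T_def)
    then show "finite (T N)" by (rule finite_subset) simp
    show "s N = (\<Sum>y\<in>T N. triple_term (snd (N, y)))"
      using sum_triple_term[of N] by (simp add: s_def T_def case_prod_unfold)
  qed
  then have "(s has_sum S) UNIV"
    by (intro has_sum_Sigma'[OF S'])
  then have "s sums S" by (rule has_sum_imp_sums)
  moreover have "s sums (G 1 + q\<^sup>2 * G (q\<^sup>2))"
    unfolding s_def
  proof (rule sums_add)
    show "(\<lambda>N. q ^ N\<^sup>2 / D N) sums G 1"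
      using summable_sums[OF G_summable[of 1]] by (simp add: G_def)
    \<comment> \<open>This is the second series after the shift \<open>N = Suc n\<close>, by
      \<open>(n + 1)^2 + 1 = n^2 + 2 * n + 2\<close>. Its term at \<open>N = 0\<close> is zero, so
      the shift does not change the sum.\<close>
    have "(\<lambda>n. q\<^sup>2 * (q ^ n\<^sup>2 / D n * (q\<^sup>2) ^ n)) sums (q\<^sup>2 * G (q\<^sup>2))"
      using summable_sums[OF G_summable[of "q\<^sup>2"]] norm_power2_less_one[OF q]
      by (intro sums_mult) (simp add: G_def)
    moreover have "q\<^sup>2 * (q ^ n\<^sup>2 / D n * (q\<^sup>2) ^ n) = q ^ (Suc n)\<^sup>2 * q / D n" for n
    proof -
      have "2 + (n\<^sup>2 + 2 * n) = (Suc n)\<^sup>2 + 1" by (simp add: power2_eq_square)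
      then have "q\<^sup>2 * (q ^ n\<^sup>2 * (q\<^sup>2) ^ n) = q ^ (Suc n)\<^sup>2 * q"
        by (metis power_add power_mult power_one_right)
      then show ?thesis by simp
    qed
    ultimately have "(\<lambda>n. q ^ (Suc n)\<^sup>2 * q / D n) sums (q\<^sup>2 * G (q\<^sup>2))"
      by (simp only:)
    then show "(\<lambda>N. if N = 0 then 0 else q ^ N\<^sup>2 * q / D (N - 1)) sums (q\<^sup>2 * G (q\<^sup>2))"
      using sums_Suc_iff[of "\<lambda>N. if N = 0 then 0 else q ^ N\<^sup>2 * q / D (N - 1)"] by simp
  qed
  ultimately have "S = G 1 + q\<^sup>2 * G (q\<^sup>2)"
    using sums_unique2 by blast
  \<comment> \<open>The shift at \<open>z = 1\<close> reads
    \<open>G 1 = (1 + q) * G (q^2)\<close>.\<close>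
  also have "\<dots> = (1 + q + q\<^sup>2) * G (q\<^sup>2)"
    using G_shift[of 1] by (simp add: algebra_simps)
  also have "G (q\<^sup>2) = qpoch_inf (- (q ^ 3)) (q\<^sup>2)"
    using G_eq_qpoch_inf[of "q\<^sup>2"] norm_power2_less_one[OF q]
    by (simp add: power_Suc[symmetric] del: power_Suc)
  finally show ?thesis using S by simp
qed

end

theorem mainTheorem5:
  fixes q :: complex
  assumes "0 < norm q" and "norm q < 1"
  shows "((\<lambda>(i, j, k). (-1) ^ i * q ^ (i^2 + 2*j^2 + k^2 + 2*i*j + 2*i*k + 2*j*k + 3*i)
            / (qpoch (q^2) (q^2) i * qpoch (q^2) (q^2) j * qpoch (q^2) (q^2) k))
          has_sum (qpoch_inf (q^6) (q^4) / (qpoch_inf q (q^4) * qpoch_inf (q^7) (q^4))))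
         (UNIV :: (nat \<times> nat \<times> nat) set)"
  using triple_term_has_sum[OF assms(2)]
  unfolding product_side[OF assms(2)] triple_term_def[OF assms(2)] .

end
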